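(* Let $p_1,\ldots,p_L$ be distinct primes, $D=p_1\cdots p_L$, $k\in\mathbb{N}$, and $t\in[1,\infty]$. Then the infimum in $M_t(D^{1/k})$ is attained by $p_1^{1/k},\ldots,p_L^{1/k}$ (positive real $k$-th roots), and $M_t(D^{1/k})=\left(\sum_{\ell=1}^L(\log p_\ell)^t\right)^{1/t}$ if $t\in[1,\infty)$, while $M_\infty(D^{1/k})=\max_{1\le\ell\le L}\log p_\ell$.
   Context: For a polynomial $f(z)=a\prod_{n=1}^N(z-\beta_n)\in\mathbb{C}[z]$, its (logarithmic) Mahler measure is $M(f)=\log|a|+\sum_{n=1}^N\log^+|\beta_n|$, where $\log^+x=\max\{0,\log x\}$. For a non-zero algebraic number $\beta$, $M(\beta)$ is the Mahler measure of the minimal polynomial of $\beta$ over $\mathbb{Z}$. For $t\in[1,\infty)$ and $\beta\in\overline{\mathbb{Q}}^\times$, $M_t(\beta)=\inf\{(\sum_{n=1}^N M(\beta_n)^t)^{1/t}: N\in\mathbb{N},\ \beta_n\in\overline{\mathbb{Q}}^\times,\ \beta=\prod_{n=1}^N\beta_n\}$, and $M_\infty(\beta)=\inf\{\max_{1\le n\le N}M(\beta_n): N\in\mathbb{N},\ \beta_n\in\overline{\mathbb{Q}}^\times,\ \beta=\prod_{n=1}^N\beta_n\}$. The infimum in $M_t(\beta)$ is attained by $\beta_1,\ldots,\beta_N$ if $\beta=\beta_1\cdots\beta_N$ and $M_t(\beta)$ equals $(\sum_n M(\beta_n)^t)^{1/t}$ (for $t<\infty$) or $\max_n M(\beta_n)$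 (for $t=\infty$). *)

theory Defs
  imports
    Complex_Main
    "HOL-Library.Extended_Real"
    "HOL-Computational_Algebra.Computational_Algebra"
begin

definition log_plus :: "real \<Rightarrow> real" where
  "log_plus x = max 0 (ln x)"

text \<open>Since \<^term>\<open>ln 0 = (0::real)\<close> in HOL, a root at 0 contributes 0, as with the usual
  convention that the logarithm of 0 is minus infinity.\<close>

definition log_mahler_poly :: "complex poly \<Rightarrow> real" where
  "log_mahler_poly f = ln (cmod (lead_coeff f)) + (\<Sum>\<beta>\<in>#proots f. log_plus (cmod \<beta>))"

text \<open>An irreducible element of the ring of integer polynomials with a complex root is
  non-constant, hence primitive; the sign condition makes it unique.
  Only meaningful for algebraic arguments.\<close>

definition int_min_poly :: "complex \<Rightarrow> int poly" where
  "int_min_poly \<beta> =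
     (THE p. irreducible p \<and> lead_coeff p > 0 \<and> poly (map_poly of_int p) \<beta> = 0)"

definition log_mahler :: "complex \<Rightarrow> real" where
  "log_mahler \<beta> = log_mahler_poly (map_poly of_int (int_min_poly \<beta>))"

text \<open>Tuples of non-zero algebraic numbers with product \<open>\<beta>\<close>; they have at least one entry.\<close>

definition alg_factorizations :: "complex \<Rightarrow> complex list set" where
  "alg_factorizations \<beta> =
     {bs. bs \<noteq> [] \<and> (\<forall>b\<in>set bs. algebraic b \<and> b \<noteq> 0) \<and> prod_list bs = \<beta>}"

definition t_mahler_of :: "ereal \<Rightarrow> complex list \<Rightarrow> real" where
  "t_mahler_of t bs =
     (if t = \<infinity> then Max (log_mahler ` set bs)
      else (\<Sum>b\<leftarrow>bs. log_mahler b powr real_of_ereal t) powr (1 / real_of_ereal t))"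

definition t_metric_mahler :: "ereal \<Rightarrow> complex \<Rightarrow> real" where
  "t_metric_mahler t \<beta> = (INF bs\<in>alg_factorizations \<beta>. t_mahler_of t bs)"

definition t_metric_mahler_attained_by :: "ereal \<Rightarrow> complex \<Rightarrow> complex list \<Rightarrow> bool" where
  "t_metric_mahler_attained_by t \<beta> bs \<longleftrightarrow>
     bs \<in> alg_factorizations \<beta> \<and> t_metric_mahler t \<beta> = t_mahler_of t bs"

end

theory Submission
  imports Defs "Jordan_Normal_Form.Char_Poly"
begin

text \<open>For a non-zero algebraic number \<open>b\<close> let \<open>c(b)\<close> be the constant coefficient of its minimal
  polynomial. Then \<open>M(b) \<ge> log |c(b)|\<close>, and \<open>c(b)/b\<close> is an algebraic integer. Given a
  factorization of \<open>D\<^bsup>1/k\<^esup>\<close> into \<open>b\<^sub>1, \<dots>, b\<^sub>N\<close> with \<open>C = c(b\<^sub>1) \<cdots> c(b\<^sub>N)\<close>, the number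
  \<open>C\<^sup>k/D\<close> is a rational algebraic integer, so every prime divisor of \<open>D\<close> divides some \<open>c(b\<^sub>n)\<close>.
  Hence \<open>M(b\<^sub>n)\<close> is at least the sum of \<open>log p\<close> over the primes \<open>p\<close> charged to \<open>b\<^sub>n\<close>, and the
  superadditivity of \<open>x \<mapsto> x\<^sup>t\<close> gives the lower bound. It is reached because
  \<open>M(p\<^bsup>1/k\<^esup>) = log p\<close>.\<close>

unbundle no fps_syntax

section \<open>Algebraic integers: closure under products, and integrality at roots of integer
  polynomials\<close>

text \<open>The characteristic polynomial of an integer matrix is monic with integer coefficients.
  Rows and columns are indexed by an arbitrary finite set \<open>S\<close>, so that pairs of
  exponents can serve as indices for products.\<close>

lemma algebraic_int_eigenvalueI:
  fixes x :: "'a :: field_char_0" and A :: "'b \<Rightarrow> 'b \<Rightarrow> int" and v :: "'b \<Rightarrow> 'a"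
  assumes fin: "finite S" and nz: "s0 \<in> S" "v s0 \<noteq> 0"
    and eig: "\<And>s. s \<in> S \<Longrightarrow> x * v s = (\<Sum>r\<in>S. of_int (A s r) * v r)"
  shows "algebraic_int x"
proof -
  define n where "n = card S"
  obtain g where g: "bij_betw g {0..<n} S"
    using ex_bij_betw_nat_finite[OF fin] by (auto simp: n_def)
  define M where "M = mat n n (\<lambda>(i, j). A (g i) (g j))"
  define w where "w = vec n (\<lambda>i. v (g i))"
  have M: "M \<in> carrier_mat n n" by (simp add: M_def)
  have MM: "(map_mat of_int M :: 'a mat) \<in> carrier_mat n n" using M by simp
  obtain i0 where i0: "i0 < n" "g i0 = s0"
    using g nz(1) by (auto simp: bij_betw_def)
  have w0: "w \<noteq> 0\<^sub>v n"
  proof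
    assume "w = 0\<^sub>v n"
    hence "w $ i0 = 0" using i0 by simp
    with i0 nz show False by (simp add: w_def)
  qed
  have "map_mat of_int M *\<^sub>v w = x \<cdot>\<^sub>v w"
  proof (rule eq_vecI)
    fix i assume "i < dim_vec (x \<cdot>\<^sub>v w)"
    hence i: "i < n" by (simp add: w_def)
    have gi: "g i \<in> S" using g i by (auto simp: bij_betw_def)
    have "(map_mat of_int M *\<^sub>v w) $ i = (\<Sum>j = 0..<n. of_int (A (g i) (g j)) * v (g j))"
      using i by (simp add: M_def w_def scalar_prod_def)
    also have "\<dots> = (\<Sum>r\<in>S. of_int (A (g i) r) * v r)"
      using sum.reindex_bij_betw[OF g] .
    also have "\<dots> = (x \<cdot>\<^sub>v w) $ i"
      using eig[OF gi] i by (simp add: w_def)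
    finally show "(map_mat of_int M *\<^sub>v w) $ i = (x \<cdot>\<^sub>v w) $ i" .
  qed (simp add: M_def w_def)
  hence "eigenvalue (map_mat of_int M) x"
    unfolding eigenvalue_def eigenvector_def using w0 M
    by (intro exI[of _ w]) (auto simp: w_def)
  hence "poly (char_poly (map_mat of_int M)) x = 0"
    using eigenvalue_root_char_poly[OF MM] by simp
  hence "poly (map_poly of_int (char_poly M)) x = 0"
    by (simp add: of_int_hom.char_poly_hom[OF M])
  moreover have "lead_coeff (char_poly M) = 1"
    using degree_monic_char_poly[OF M] by simp
  ultimately show ?thesis
    unfolding algebraic_int_altdef_ipoly by blast
qed

text \<open>The powers of \<open>x\<close> below the degree of a monic relation form an eigenvector
  of its companion matrix \<open>A\<close>, with eigenvalue \<open>x\<close>.\<close>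

lemma algebraic_int_powers_relation:
  fixes x :: "'a :: field_char_0"
  assumes "algebraic_int x"
  obtains m :: nat and A :: "nat \<Rightarrow> nat \<Rightarrow> int"
  where "m > 0" and "\<And>i. i < m \<Longrightarrow> x * x ^ i = (\<Sum>j<m. of_int (A i j) * x ^ j)"
proof -
  from assms obtain p where p: "poly (map_poly of_int p) x = 0" "lead_coeff p = 1"
    unfolding algebraic_int_altdef_ipoly by blast
  define m where "m = degree p"
  \<comment> \<open>Every row but the last shifts to the next power; the last row rewrites
    \<open>x ^ m\<close> by the monic relation.\<close>
  define A where "A i j = (if Suc i < m then (if j = Suc i then 1 else 0) else - coeff p j)" for i j
  have m: "m > 0"
  proof (rule ccontr)
    assume "\<not> m > 0"
    then obtain c where "p = [:c:]" by (auto simp: m_def elim: degree_eq_zeroE)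
    with p show False by simp
  qed
  have "0 = (\<Sum>j\<le>m. of_int (coeff p j) * x ^ j)"
    using p by (simp add: poly_altdef m_def)
  also have "\<dots> = (\<Sum>j<m. of_int (coeff p j) * x ^ j) + x ^ m"
    using p by (simp add: m_def lessThan_Suc_atMost[symmetric])
  finally have top: "x ^ m = (\<Sum>j<m. of_int (- coeff p j) * x ^ j)"
    by (simp add: sum_negf eq_neg_iff_add_eq_0 add.commute)
  have "x * x ^ i = (\<Sum>j<m. of_int (A i j) * x ^ j)" if "i < m" for i
  proof (cases "Suc i < m")
    case True
    have "(\<Sum>j<m. of_int (A i j) * x ^ j) = (\<Sum>j<m. if j = Suc i then x ^ j else 0)"
      using True by (intro sum.cong) (auto simp: A_def)
    thus ?thesis using True by simp
  next
    case False
    with that have "m = Suc i" by simp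
    thus ?thesis using top False by (simp add: A_def)
  qed
  with m show ?thesis by (rule that)
qed

text \<open>\<open>x y\<close> is an eigenvalue of the Kronecker product of two integer matrices with
  eigenvalues \<open>x\<close> and \<open>y\<close>.\<close>

lemma algebraic_int_mult:
  fixes x y :: "'a :: field_char_0"
  assumes "algebraic_int x" "algebraic_int y"
  shows "algebraic_int (x * y)"
proof -
  obtain m A where m: "m > 0" and A: "\<And>i. i < m \<Longrightarrow> x * x ^ i = (\<Sum>j<m. of_int (A i j) * x ^ j)"
    using algebraic_int_powers_relation[OF assms(1)] by blast
  obtain n B where n: "n > 0" and B: "\<And>i. i < n \<Longrightarrow> y * y ^ i = (\<Sum>j<n. of_int (B i j) * y ^ j)"
    using algebraic_int_powers_relation[OF assms(2)] by blast
  show ?thesis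
  proof (rule algebraic_int_eigenvalueI)
    show "finite ({..<m} \<times> {..<n})" by simp
    show "(0, 0) \<in> {..<m} \<times> {..<n}" using m n by simp
    show "(case (0, 0) of (i, j) \<Rightarrow> x ^ i * y ^ j) \<noteq> 0" by simp
    fix s assume s: "s \<in> {..<m} \<times> {..<n}"
    obtain i j where ij: "s = (i, j)" "i < m" "j < n" using s by auto
    have "x * y * (case s of (i, j) \<Rightarrow> x ^ i * y ^ j) = (x * x ^ i) * (y * y ^ j)"
      by (simp add: ij mult_ac)
    also have "\<dots> = (\<Sum>i'<m. \<Sum>j'<n. (of_int (A i i') * x ^ i') * (of_int (B j j') * y ^ j'))"
      by (simp only: A[OF ij(2)] B[OF ij(3)] sum_product)
    also have "\<dots> = (\<Sum>r\<in>{..<m} \<times> {..<n}.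
        of_int ((\<lambda>(i, j) (i', j'). A i i' * B j j') s r) * (case r of (i, j) \<Rightarrow> x ^ i * y ^ j))"
      by (simp add: sum.cartesian_product ij case_prod_unfold mult_ac)
    finally show "x * y * (case s of (i, j) \<Rightarrow> x ^ i * y ^ j) = (\<Sum>r\<in>{..<m} \<times> {..<n}.
        of_int ((\<lambda>(i, j) (i', j'). A i i' * B j j') s r) * (case r of (i, j) \<Rightarrow> x ^ i * y ^ j))" .
  qed
qed

lemma algebraic_int_power:
  fixes x :: "'a :: field_char_0"
  shows "algebraic_int x \<Longrightarrow> algebraic_int (x ^ n)"
  by (induction n) (auto intro: algebraic_int_mult)

lemma algebraic_int_prod_list:
  fixes xs :: "'a :: field_char_0 list"
  shows "(\<And>x. x \<in> set xs \<Longrightarrow> algebraic_int x) \<Longrightarrow> algebraic_int (prod_list xs)"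
  by (induction xs) (auto intro: algebraic_int_mult)

text \<open>With \<open>c\<close> the leading coefficient and \<open>n\<close> the degree,
  multiplying the relation for \<open>x\<close> by \<open>c ^ (n - 1)\<close> turns it into a monic
  relation for \<open>c * x\<close>.\<close>

lemma algebraic_int_lead_coeff_mult:
  fixes x :: "'a :: field_char_0"
  assumes root: "poly (map_poly of_int p) x = 0" and "p \<noteq> 0"
  shows "algebraic_int (of_int (lead_coeff p) * x)"
proof -
  define n where "n = degree p"
  define c where "c = lead_coeff p"
  have n: "n > 0"
  proof (rule ccontr)
    assume "\<not> n > 0"
    then obtain c where "p = [:c:]" by (auto simp: n_def elim: degree_eq_zeroE)
    with assms show False by simp
  qed
  \<comment> \<open>The value of \<open>q\<close> at \<open>c * x\<close> is
    \<open>c ^ (n - 1)\<close> times the value of \<open>p\<close> at \<open>x\<close>.\<close>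
  define q where "q = monom 1 n + (\<Sum>i<n. monom (coeff p i * c ^ (n - 1 - i)) i)"
  have coeff_q: "coeff q j = (if j = n then 1 else 0) +
      (if j < n then coeff p j * c ^ (n - 1 - j) else 0)" for j
  proof -
    have "(\<Sum>i<n. coeff (monom (coeff p i * c ^ (n - 1 - i)) i) j) =
        (\<Sum>i<n. if i = j then coeff p i * c ^ (n - 1 - i) else 0)"
      by (intro sum.cong) auto
    thus ?thesis by (auto simp: q_def coeff_sum)
  qed
  have deg: "degree q = n"
    by (intro antisym degree_le le_degree) (auto simp: coeff_q)
  have "poly (map_poly of_int q) (of_int c * x) =
      (\<Sum>i\<le>n. of_int (coeff q i) * (of_int c * x) ^ i)"
    by (simp add: poly_altdef deg)
  also have "\<dots> = (\<Sum>i<n. of_int (coeff q i) * (of_int c * x) ^ i) + (of_int c * x) ^ n"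
    by (simp add: lessThan_Suc_atMost[symmetric] coeff_q)
  also have "(\<Sum>i<n. of_int (coeff q i) * (of_int c * x) ^ i) =
      (\<Sum>i<n. of_int c ^ (n - 1) * (of_int (coeff p i) * x ^ i))"
  proof (intro sum.cong refl)
    fix i assume "i \<in> {..<n}"
    hence i: "i < n" by simp
    hence "(of_int c :: 'a) ^ (n - 1) = of_int c ^ (n - 1 - i) * of_int c ^ i"
      by (simp add: power_add[symmetric])
    thus "of_int (coeff q i) * (of_int c * x) ^ i = of_int c ^ (n - 1) * (of_int (coeff p i) * x ^ i)"
      using i by (simp add: coeff_q power_mult_distrib mult_ac)
  qed
  \<comment> \<open>One of the \<open>n\<close> factors \<open>c\<close> plays the part of
    \<open>coeff p n\<close>; this requires \<open>n > 0\<close>.\<close>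
  also have "(of_int c * x) ^ n = of_int c ^ (n - 1) * (of_int (coeff p n) * x ^ n)"
    using n by (cases n) (simp_all add: c_def n_def[symmetric] power_mult_distrib mult_ac)
  also have "(\<Sum>i<n. of_int c ^ (n - 1) * (of_int (coeff p i) * x ^ i)) +
      of_int c ^ (n - 1) * (of_int (coeff p n) * x ^ n) =
      of_int c ^ (n - 1) * (\<Sum>i\<le>n. of_int (coeff p i) * x ^ i)"
    by (simp add: lessThan_Suc_atMost[symmetric] sum_distrib_left distrib_left)
  also have "(\<Sum>i\<le>n. of_int (coeff p i) * x ^ i) = 0"
    using root by (simp add: poly_altdef n_def)
  finally have "poly (map_poly of_int q) (of_int c * x) = 0" by simp
  moreover have "lead_coeff q = 1" by (simp add: deg coeff_q)
  ultimately show ?thesis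
    unfolding algebraic_int_altdef_ipoly c_def by blast
qed

text \<open>The inverse of \<open>x\<close> is a root of the reversed polynomial, whose leading
  coefficient is \<open>coeff p 0\<close>.\<close>

lemma algebraic_int_const_coeff_divide:
  fixes x :: "'a :: field_char_0"
  assumes root: "poly (map_poly of_int p) x = 0" and "coeff p 0 \<noteq> 0" "x \<noteq> 0"
  shows "algebraic_int (of_int (coeff p 0) / x)"
proof -
  have "map_poly of_int (reflect_poly p) = reflect_poly (map_poly of_int p :: 'a poly)"
    by (intro poly_eqI) (auto simp: coeff_reflect_poly)
  hence "poly (map_poly of_int (reflect_poly p)) (inverse x) = 0"
    using root \<open>x \<noteq> 0\<close> by (simp add: poly_reflect_poly_nz)
  from algebraic_int_lead_coeff_mult[OF this] show ?thesis
    using assms by (cases "p = 0") (auto simp: divide_inverse coeff_reflect_poly)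
qed

section \<open>Minimal polynomials over the integers\<close>

text \<open>A primitive integer polynomial of least degree vanishing at \<open>\<beta>\<close> divides, by
  pseudo-division and Gauss's lemma, every integer polynomial vanishing at \<open>\<beta>\<close>. It is
  therefore a prime element, and the only candidate for the minimal polynomial.\<close>

lemma int_min_poly_props:
  assumes "algebraic \<beta>"
  shows irreducible_int_min_poly: "irreducible (int_min_poly \<beta>)"
    and lead_coeff_int_min_poly_pos: "lead_coeff (int_min_poly \<beta>) > 0"
    and poly_int_min_poly: "poly (map_poly of_int (int_min_poly \<beta>)) \<beta> = 0"
    and int_min_poly_dvd: "\<And>g. poly (map_poly of_int g) \<beta> = 0 \<Longrightarrow> int_min_poly \<beta> dvd g"
proof -
  define ev where "ev g = poly (map_poly of_int g :: complex poly) \<beta>" for g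
  have ev_mult: "ev (g * h) = ev g * ev h" and ev_add: "ev (g + h) = ev g + ev h"
    and ev_smult: "ev (Polynomial.smult c g) = of_int c * ev g" for g h c
    by (simp_all add: ev_def of_int_hom.map_poly_hom_smult
        of_int_poly_hom.hom_mult of_int_poly_hom.hom_add)
  obtain q0 where q0: "q0 \<noteq> 0" "ev q0 = 0"
    using algebraicE'[OF assms] unfolding ev_def by blast
  define q1 where "q1 = (ARG_MIN degree g. g \<noteq> 0 \<and> ev g = 0)"
  have q1: "q1 \<noteq> 0 \<and> ev q1 = 0"
    unfolding q1_def by (rule arg_min_natI) (use q0 in blast)
  have q1_min: "degree q1 \<le> degree g" if "g \<noteq> 0" "ev g = 0" for g
    unfolding q1_def by (rule arg_min_nat_le) (use that in blast)
  define q2 where "q2 = primitive_part q1"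
  define q where "q = (if lead_coeff q2 > 0 then q2 else - q2)"
  have q2: "q2 \<noteq> 0" "content q2 = 1" "degree q2 = degree q1"
    using q1 by (simp_all add: q2_def)
  have "ev q1 = of_int (content q1) * ev q2"
    unfolding q2_def ev_smult[symmetric] by simp
  hence ev_q2: "ev q2 = 0" using q1 by simp
  have "ev (- q2) = of_int (- 1) * ev q2"
    unfolding ev_smult[symmetric] by simp
  hence q: "q \<noteq> 0" "ev q = 0" "content q = 1" "degree q = degree q1"
    using q2 ev_q2 content_smult[of "- 1" q2] by (auto simp: q_def)
  have q_lead: "lead_coeff q > 0"
    using q2(1) by (auto simp: q_def not_less order_less_le)
  have q_dvd: "q dvd g" if g: "ev g = 0" for g
  proof -
    obtain a s where as: "a \<noteq> 0" "Polynomial.smult a g = q * s + pseudo_mod g q"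
      using pseudo_mod(1)[OF q(1), of g] by blast
    have "ev (Polynomial.smult a g) = ev q * ev s + ev (pseudo_mod g q)"
      by (simp only: as ev_add ev_mult)
    hence "ev (pseudo_mod g q) = 0" using g q by (simp add: ev_smult)
    \<comment> \<open>A nonzero remainder would vanish at \<beta> with degree below the least
      possible one.\<close>
    hence "pseudo_mod g q = 0"
      using pseudo_mod(2)[OF q(1), of g] q1_min[of "pseudo_mod g q"] q by force
    with as have "Polynomial.smult a g = q * s" by simp
    hence "fract_poly (Polynomial.smult a g) = fract_poly q * fract_poly s" by simp
    hence "Polynomial.smult (to_fract a) (fract_poly g) = fract_poly q * fract_poly s" by simp
    hence "fract_poly q dvd Polynomial.smult (to_fract a) (fract_poly g)" by simp
    hence "fract_poly q dvd fract_poly g"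
      using as(1) by (simp add: dvd_smult_iff)
    thus ?thesis using q(3) by (rule fract_poly_dvdD)
  qed
  have q_nonunit: "\<not> q dvd 1"
  proof
    assume "q dvd 1"
    then obtain r where "1 = q * r" by blast
    hence "ev 1 = ev q * ev r" by (metis ev_mult)
    thus False using q by (simp add: ev_def)
  qed
  have "prime_elem q"
  proof (rule prime_elemI)
    fix a b assume "q dvd a * b"
    then obtain r where "a * b = q * r" by blast
    hence "ev a * ev b = 0" using q by (metis ev_mult mult_zero_left)
    thus "q dvd a \<or> q dvd b" using q_dvd by auto
  qed (use q q_nonunit in auto)
  hence q_irred: "irreducible q" by (rule prime_elem_imp_irreducible)
  have "int_min_poly \<beta> = q"
    unfolding int_min_poly_def
  proof (rule the_equality)
    show "irreducible q \<and> lead_coeff q > 0 \<and> poly (map_poly of_int q) \<beta> = 0"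
      using q_irred q_lead q by (simp add: ev_def)
    fix p :: "int poly"
    assume p: "irreducible p \<and> lead_coeff p > 0 \<and> poly (map_poly of_int p) \<beta> = 0"
    then obtain u where u: "p = q * u" using q_dvd[of p] by (auto simp: ev_def)
    \<comment> \<open>The cofactor of any other candidate is a unit, thus 1 or -1, and the positive
      leading coefficients exclude -1.\<close>
    hence "u dvd 1" using p q_nonunit by (auto dest: irreducibleD)
    then obtain c where c: "u = [:c:]" "c dvd 1" by (auto simp: is_unit_poly_iff)
    hence "p = Polynomial.smult c q" using u by simp
    moreover have "c = 1 \<or> c = - 1" using c(2) by (auto simp: zdvd1_eq)
    ultimately show "p = q" using p q_lead by auto
  qed
  with q_irred q_lead q q_dvd
  show "irreducible (int_min_poly \<beta>)" "lead_coeff (int_min_poly \<beta>) > 0"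
    "poly (map_poly of_int (int_min_poly \<beta>)) \<beta> = 0"
    "\<And>g. poly (map_poly of_int g) \<beta> = 0 \<Longrightarrow> int_min_poly \<beta> dvd g"
    by (simp_all add: ev_def)
qed

text \<open>Otherwise the variable splits off, and the cofactor still vanishes at \<beta>, so the
  minimal polynomial would divide a polynomial of smaller degree.\<close>

lemma coeff_0_int_min_poly_nonzero:
  assumes "algebraic \<beta>" "\<beta> \<noteq> 0"
  shows "coeff (int_min_poly \<beta>) 0 \<noteq> 0"
proof
  assume 0: "coeff (int_min_poly \<beta>) 0 = 0"
  obtain a h where "int_min_poly \<beta> = pCons a h" by (cases "int_min_poly \<beta>")
  with 0 have h: "int_min_poly \<beta> = pCons 0 h" by simp
  have nz: "h \<noteq> 0"
    using irreducible_int_min_poly[OF assms(1)] h by auto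
  have "\<beta> * poly (map_poly of_int h) \<beta> = 0"
    using poly_int_min_poly[OF assms(1)] by (simp add: h of_int_hom.map_poly_pCons_hom)
  hence "int_min_poly \<beta> dvd h"
    using assms by (intro int_min_poly_dvd) auto
  hence "degree (int_min_poly \<beta>) \<le> degree h" using nz by (rule dvd_imp_degree_le)
  thus False using nz by (simp add: h)
qed

section \<open>Lower bounds for the Mahler measure from the constant coefficient\<close>

text \<open>Up to sign the constant coefficient is the leading coefficient times the product of the
  roots, and \<open>ln\<close> is at most \<open>log_plus\<close> at each root.\<close>

lemma ln_const_coeff_le_log_mahler_poly:
  assumes "coeff f 0 \<noteq> 0"
  shows "ln (cmod (coeff f 0)) \<le> log_mahler_poly f"
proof -
  have f: "f \<noteq> 0" using assms by auto
  have roots: "x \<noteq> 0" if "x \<in># proots f" for x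
    using that f assms by (auto simp: poly_0_coeff_0)
  have "coeff f 0 = poly (Polynomial.smult (lead_coeff f) (\<Prod>x\<in>#proots f. [:-x, 1:])) 0"
    by (simp only: complex_poly_decompose_multiset poly_0_coeff_0)
  also have "\<dots> = lead_coeff f * (\<Prod>x\<in>#proots f. - x)"
    by (simp add: poly_prod_mset)
  finally have "cmod (coeff f 0) = cmod (lead_coeff f) * cmod (\<Prod>x\<in>#proots f. - x)"
    by (simp add: norm_mult)
  \<comment> \<open>Nonvanishing is carried through the induction because splitting
    \<open>ln\<close> of a product requires nonzero factors.\<close>
  moreover have "cmod (\<Prod>x\<in>#A. - x) \<noteq> 0 \<and>
      ln (cmod (\<Prod>x\<in>#A. - x)) \<le> (\<Sum>x\<in>#A. log_plus (cmod x))"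
    if "\<And>x. x \<in># A \<Longrightarrow> x \<noteq> 0" for A
    using that
  proof (induction A)
    case (add a A)
    hence "a \<noteq> 0" and IH: "(\<Prod>x\<in>#A. - x) \<noteq> 0"
        "ln (cmod (\<Prod>x\<in>#A. - x)) \<le> (\<Sum>x\<in>#A. log_plus (cmod x))"
      by auto
    have "ln (cmod (\<Prod>x\<in>#add_mset a A. - x)) = ln (cmod a) + ln (cmod (\<Prod>x\<in>#A. - x))"
      using \<open>a \<noteq> 0\<close> IH(1) by (simp add: norm_mult ln_mult)
    also have "\<dots> \<le> log_plus (cmod a) + (\<Sum>x\<in>#A. log_plus (cmod x))"
      using IH(2) by (intro add_mono) (auto simp: log_plus_def)
    finally show ?case using \<open>a \<noteq> 0\<close> IH(1) by simp
  qed auto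
  from this[of "proots f"] roots have "cmod (\<Prod>x\<in>#proots f. - x) \<noteq> 0"
      "ln (cmod (\<Prod>x\<in>#proots f. - x)) \<le> (\<Sum>x\<in>#proots f. log_plus (cmod x))"
    by blast+
  ultimately show ?thesis
    using f by (simp add: log_mahler_poly_def ln_mult)
qed

lemma ln_const_coeff_le_log_mahler:
  assumes "algebraic \<beta>" "\<beta> \<noteq> 0"
  shows "ln \<bar>real_of_int (coeff (int_min_poly \<beta>) 0)\<bar> \<le> log_mahler \<beta>"
  using ln_const_coeff_le_log_mahler_poly[of "map_poly of_int (int_min_poly \<beta>)"]
    coeff_0_int_min_poly_nonzero[OF assms]
  by (simp add: log_mahler_def)

lemma prod_primes_dvd:
  fixes n :: nat
  assumes "finite P" "\<And>p. p \<in> P \<Longrightarrow> prime p" "\<And>p. p \<in> P \<Longrightarrow> p dvd n"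
  shows "\<Prod>P dvd n"
  using assms
proof (induction P rule: finite_induct)
  case (insert p P)
  have "coprime p (\<Prod>P)"
    using insert by (intro prod_coprime_right primes_coprime) auto
  with insert show ?case by (auto intro: divides_mult)
qed auto

text \<open>The product of the distinct primes in \<open>P\<close> divides the nonzero constant
  coefficient, so it is at most its absolute value.\<close>

lemma sum_ln_prime_divisors_le_log_mahler:
  assumes \<beta>: "algebraic \<beta>" "\<beta> \<noteq> 0" and P: "finite P" "\<And>p. p \<in> P \<Longrightarrow> prime p"
    and dvd: "\<And>p. p \<in> P \<Longrightarrow> int p dvd coeff (int_min_poly \<beta>) 0"
  shows "(\<Sum>p\<in>P. ln (real p)) \<le> log_mahler \<beta>"
proof -
  define c where "c = coeff (int_min_poly \<beta>) 0"
  have c: "c \<noteq> 0" using coeff_0_int_min_poly_nonzero[OF \<beta>] by (simp add: c_def)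
  have "\<Prod>P dvd nat \<bar>c\<bar>"
    using P dvd by (intro prod_primes_dvd) (auto simp: c_def dvd_nat_abs_iff)
  hence le: "\<Prod>P \<le> nat \<bar>c\<bar>" using c by (intro dvd_imp_le) auto
  have pos: "p > 0" if "p \<in> P" for p using P that by (auto simp: prime_gt_0_nat)
  have "(\<Sum>p\<in>P. ln (real p)) = ln (\<Prod>p\<in>P. real p)"
    using P pos by (subst ln_prod) auto
  also have "(\<Prod>p\<in>P. real p) = real (\<Prod>P)" by simp
  also have "ln \<dots> \<le> ln (real (nat \<bar>c\<bar>))"
  proof (rule ln_mono)
    show "real (\<Prod>P) \<le> real (nat \<bar>c\<bar>)" using le by (simp only: of_nat_le_iff)
    show "real (\<Prod>P) > 0" using pos by (simp add: prod_pos)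
  qed
  also have "real (nat \<bar>c\<bar>) = \<bar>real_of_int c\<bar>" by simp
  also have "ln \<dots> \<le> log_mahler \<beta>"
    unfolding c_def by (rule ln_const_coeff_le_log_mahler[OF \<beta>])
  finally show ?thesis .
qed

section \<open>Prime divisors of \<open>D\<close> in an arbitrary factorization\<close>

text \<open>The product of the algebraic integers \<open>c b / b\<close> is
  \<open>C / \<alpha>\<close>. Its \<open>k\<close>-th power is rational, hence an integer, which
  leaves a plain divisibility between integers.\<close>

lemma prime_dvd_const_coeff_of_factorization:
  assumes bs: "bs \<in> alg_factorizations \<alpha>" and pow: "\<alpha> ^ k = of_nat D"
    and p: "prime p" "p dvd D" and D: "D > 0"
  shows "\<exists>b\<in>set bs. int p dvd coeff (int_min_poly b) 0"
proof -
  define c where "c b = coeff (int_min_poly b) 0" for b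
  define C where "C = prod_list (map c bs)"
  have b: "algebraic b" "b \<noteq> 0" if "b \<in> set bs" for b
    using that bs by (auto simp: alg_factorizations_def)
  have "algebraic_int (prod_list (map (\<lambda>b. of_int (c b) / b) bs))"
  proof (rule algebraic_int_prod_list)
    fix x assume "x \<in> set (map (\<lambda>b. of_int (c b) / b) bs)"
    then obtain b where x: "x = of_int (c b) / b" and "b \<in> set bs" by auto
    thus "algebraic_int x"
      unfolding x c_def
      by (intro algebraic_int_const_coeff_divide poly_int_min_poly coeff_0_int_min_poly_nonzero b)
  qed
  also have "prod_list (map (\<lambda>b. of_int (c b) / b) bs) = of_int C / prod_list bs"
    unfolding C_def by (induction bs) auto
  also have "prod_list bs = \<alpha>" using bs by (simp add: alg_factorizations_def)
  finally have "algebraic_int ((of_int C / \<alpha>) ^ k)" by (rule algebraic_int_power)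
  hence int: "algebraic_int (of_int (C ^ k) / of_nat D :: complex)"
    by (simp add: power_divide pow)
  have "(of_int (C ^ k) / of_nat D :: complex) \<in> \<int>"
    by (rule rational_algebraic_int_is_int[OF int]) (intro Rats_divide Rats_of_int Rats_of_nat)
  then obtain m where "(of_int (C ^ k) / of_nat D :: complex) = of_int m" by (elim Ints_cases)
  hence "(of_int (C ^ k) :: complex) = of_int (m * int D)"
    using D by (simp add: field_simps)
  hence "C ^ k = m * int D" by (simp only: of_int_eq_iff)
  hence "int D dvd C ^ k" by simp
  hence "int p dvd C ^ k" using p by (meson dvd_trans int_dvd_int_iff)
  hence "int p dvd C" using p(1) by (meson prime_dvd_power prime_nat_int_transfer)
  hence "int p dvd prod_mset (mset (map c bs))" unfolding C_def by (simp only: prod_mset_prod_list)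
  thus ?thesis
    using p(1) by (subst (asm) prime_dvd_prod_mset_iff) (auto simp: c_def)
qed

section \<open>The Mahler measure of the \<open>k\<close>-th root of a prime\<close>

text \<open>The minimal polynomial \<open>f\<close> of \<open>p\<^bsup>1/k\<^esup>\<close> divides \<open>x\<^sup>k - p\<close>, which bounds the Mahler
  measure from above without knowing that \<open>x\<^sup>k - p\<close> is irreducible; the lower bound comes from
  \<open>p\<close> dividing the constant coefficient of \<open>f\<close>.\<close>

lemma log_mahler_root_prime:
  assumes p: "prime p" and k: "k \<ge> 1"
  shows "log_mahler (complex_of_real (root k (real p))) = ln (real p)"
proof (rule antisym)
  define r where "r = complex_of_real (root k (real p))"
  have p0: "p > 0" using p by (simp add: prime_gt_0_nat)
  have r_pow: "r ^ k = of_nat p"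
    using k p0 by (simp add: r_def of_real_power[symmetric])
  have r: "algebraic r" "r \<noteq> 0"
    using p0 k by (auto simp: r_def)
  \<comment> \<open>The one-entry factorization, with \<open>p\<close> in the place of
    \<open>D\<close>, forces \<open>p\<close> into the constant coefficient of the minimal
    polynomial of \<open>r\<close> itself.\<close>
  have "[r] \<in> alg_factorizations r" using r by (simp add: alg_factorizations_def)
  from prime_dvd_const_coeff_of_factorization[OF this r_pow p dvd_refl p0]
  have "int p dvd coeff (int_min_poly r) 0" by simp
  with sum_ln_prime_divisors_le_log_mahler[OF r, of "{p}"] p
  show "ln (real p) \<le> log_mahler (complex_of_real (root k (real p)))"
    by (simp add: r_def)
  define f where "f = int_min_poly r"
  define F where "F = (map_poly of_int f :: complex poly)"
  define g where "g = monom 1 k - [:int p:]"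
  have poly_g: "poly (map_poly of_int g) x = x ^ k - of_nat p" for x :: complex
    by (simp add: g_def of_int_poly_hom.hom_minus of_int_hom.map_poly_pCons_hom poly_monom)
  have deg_g: "degree g = k" "lead_coeff g = 1"
  proof -
    have "degree (- [:int p:]) < degree (monom 1 k :: int poly)" using k by (simp add: degree_monom_eq)
    from degree_add_eq_left[OF this] show deg: "degree g = k"
      unfolding g_def diff_conv_add_uminus
      by (simp only: degree_monom_eq one_neq_zero not_False_eq_True)
    show "lead_coeff g = 1" unfolding deg using k by (simp add: g_def coeff_pCons split: nat.split)
  qed
  have "f dvd g"
    unfolding f_def by (rule int_min_poly_dvd[OF r(1)]) (simp add: poly_g r_pow)
  then obtain h where h: "g = f * h" by blast
  have g0: "g \<noteq> 0" using deg_g by auto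
  have deg_f: "degree f \<le> k" using dvd_imp_degree_le[OF \<open>f dvd g\<close> g0] deg_g by simp
  \<comment> \<open>Since \<open>g\<close> is monic, the positive leading coefficient of
    \<open>f\<close> is a unit, hence 1, and contributes nothing to the Mahler measure.\<close>
  have "lead_coeff f * lead_coeff h = 1" using deg_g(2) by (simp add: h lead_coeff_mult)
  hence lead_f: "lead_coeff f = 1"
    using lead_coeff_int_min_poly_pos[OF r(1)] by (simp add: f_def zmult_eq_1_iff)
  hence F: "F \<noteq> 0" "lead_coeff F = 1" "degree F = degree f" by (auto simp: F_def)
  \<comment> \<open>Every root of \<open>F\<close> is a root of \<open>g\<close>, so all have the
    same modulus; there are at most \<open>k\<close> of them with multiplicity.\<close>
  have root_norm: "log_plus (cmod x) = ln (real p) / real k" if "x \<in># proots F" for x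
  proof -
    have "poly F x = 0" using that F by simp
    hence "poly (map_poly of_int g) x = 0"
      by (simp add: h F_def of_int_poly_hom.hom_mult)
    hence "x ^ k = of_nat p" by (simp add: poly_g)
    hence "cmod x ^ k = real p" by (metis norm_of_nat norm_power)
    hence "real k * ln (cmod x) = ln (real p)"
      using ln_realpow[of "cmod x" k] p0 k by (cases "cmod x = 0") auto
    hence "ln (cmod x) = ln (real p) / real k" using k by (simp add: field_simps)
    thus ?thesis using p0 by (simp add: log_plus_def)
  qed
  have "log_mahler r = (\<Sum>x\<in>#proots F. log_plus (cmod x))"
    by (simp add: log_mahler_def log_mahler_poly_def f_def[symmetric] F_def[symmetric] F(2))
  also have "\<dots> = (\<Sum>x\<in>#proots F. ln (real p) / real k)"
    by (intro arg_cong[where f = sum_mset] image_mset_cong root_norm)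
  also have "\<dots> = real (degree f) * (ln (real p) / real k)"
    by (simp add: sum_mset_constant size_proots_complex F)
  also have "\<dots> \<le> real k * (ln (real p) / real k)"
    using deg_f p0 by (intro mult_right_mono) auto
  also have "\<dots> = ln (real p)" using k by simp
  finally show "log_mahler (complex_of_real (root k (real p))) \<le> ln (real p)"
    by (simp add: r_def)
qed

section \<open>Power sums and the lower bound for all factorizations\<close>

text \<open>With \<open>y\<close> the full sum, each \<open>x s powr t\<close> is \<open>x s\<close>
  times \<open>x s powr (t - 1)\<close>, and the second factor is at most
  \<open>y powr (t - 1)\<close>.\<close>

lemma sum_powr_le_powr_sum:
  fixes x :: "'a \<Rightarrow> real"
  assumes "finite S" "\<And>s. s \<in> S \<Longrightarrow> x s \<ge> 0" "t \<ge> 1"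
  shows "(\<Sum>s\<in>S. x s powr t) \<le> (\<Sum>s\<in>S. x s) powr t"
proof -
  define y where "y = (\<Sum>s\<in>S. x s)"
  have y: "y \<ge> 0" unfolding y_def using assms by (intro sum_nonneg)
  have "(\<Sum>s\<in>S. x s powr t) \<le> (\<Sum>s\<in>S. x s * y powr (t - 1))"
  proof (rule sum_mono)
    fix s assume s: "s \<in> S"
    have "x s powr t = x s * x s powr (t - 1)"
      using assms(2)[OF s] by (subst powr_mult_base) auto
    also have "\<dots> \<le> x s * y powr (t - 1)"
      using assms s by (intro mult_left_mono powr_mono2) (auto simp: y_def intro: member_le_sum)
    finally show "x s powr t \<le> x s * y powr (t - 1)" .
  qed
  also have "\<dots> = y * y powr (t - 1)" by (simp add: y_def sum_distrib_right)
  also have "\<dots> = y powr t" using y by (subst powr_mult_base) auto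
  finally show ?thesis by (simp add: y_def)
qed

text \<open>Each \<open>p\<close> is counted at least once on the right, and double counting only
  helps since \<open>f\<close> is nonnegative. The proof sums over list positions because entries
  may repeat.\<close>

lemma sum_le_sum_list_cover:
  fixes f :: "'a \<Rightarrow> real"
  assumes P: "finite P" and f: "\<And>p. p \<in> P \<Longrightarrow> f p \<ge> 0"
    and cover: "\<And>p. p \<in> P \<Longrightarrow> \<exists>b\<in>set bs. Q b p"
  shows "sum f P \<le> (\<Sum>b\<leftarrow>bs. sum f {p \<in> P. Q b p})"
proof -
  have "sum f P \<le> (\<Sum>p\<in>P. \<Sum>i = 0..<length bs. if Q (bs ! i) p then f p else 0)"
  proof (rule sum_mono)
    fix p assume p: "p \<in> P"
    then obtain i where i: "i < length bs" "Q (bs ! i) p"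
      using cover by (metis in_set_conv_nth)
    have "f p = (if Q (bs ! i) p then f p else 0)" using i by simp
    also have "\<dots> \<le> (\<Sum>i = 0..<length bs. if Q (bs ! i) p then f p else 0)"
      using i f[OF p] by (intro member_le_sum) auto
    finally show "f p \<le> (\<Sum>i = 0..<length bs. if Q (bs ! i) p then f p else 0)" .
  qed
  also have "\<dots> = (\<Sum>i = 0..<length bs. \<Sum>p\<in>P. if Q (bs ! i) p then f p else 0)"
    by (rule sum.swap)
  also have "\<dots> = (\<Sum>b\<leftarrow>bs. sum f {p \<in> P. Q b p})"
    using P by (simp add: sum_list_sum_nth sum.inter_filter)
  finally show ?thesis .
qed

text \<open>Each entry is charged with all primes of \<open>P\<close> dividing its constant
  coefficient; superadditivity of the power \<open>t\<close> compares the charge with the Mahler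
  measure of that entry.\<close>

lemma sum_ln_powr_le_sum_log_mahler_powr:
  assumes bs: "bs \<in> alg_factorizations \<alpha>" and pow: "\<alpha> ^ k = of_nat D" and D: "D > 0"
    and P: "finite P" "\<And>p. p \<in> P \<Longrightarrow> prime p" "\<And>p. p \<in> P \<Longrightarrow> p dvd D"
    and t: "t \<ge> 1"
  shows "(\<Sum>p\<in>P. ln (real p) powr t) \<le> (\<Sum>b\<leftarrow>bs. log_mahler b powr t)"
proof -
  define Q where "Q b p \<longleftrightarrow> int p dvd coeff (int_min_poly b) 0" for b p
  have ln_nonneg: "ln (real p) \<ge> 0" if "p \<in> P" for p
    using prime_ge_1_nat[OF P(2)[OF that]] by simp
  have "(\<Sum>p\<in>P. ln (real p) powr t) \<le> (\<Sum>b\<leftarrow>bs. \<Sum>p\<in>{p \<in> P. Q b p}. ln (real p) powr t)"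
    using prime_dvd_const_coeff_of_factorization[OF bs pow _ _ D] P
    by (intro sum_le_sum_list_cover) (auto simp: Q_def)
  also have "\<dots> \<le> (\<Sum>b\<leftarrow>bs. log_mahler b powr t)"
  proof (rule sum_list_mono)
    fix b assume "b \<in> set bs"
    hence b: "algebraic b" "b \<noteq> 0" using bs by (auto simp: alg_factorizations_def)
    have "(\<Sum>p\<in>{p \<in> P. Q b p}. ln (real p) powr t) \<le> (\<Sum>p\<in>{p \<in> P. Q b p}. ln (real p)) powr t"
      using P t ln_nonneg by (intro sum_powr_le_powr_sum) auto
    also have "\<dots> \<le> log_mahler b powr t"
      using P t ln_nonneg b
      by (intro powr_mono2 sum_nonneg sum_ln_prime_divisors_le_log_mahler) (auto simp: Q_def)
    finally show "(\<Sum>p\<in>{p \<in> P. Q b p}. ln (real p) powr t) \<le> log_mahler b powr t" .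
  qed
  finally show ?thesis .
qed

text \<open>For \<open>t = \<infinity>\<close> each prime is treated alone: an entry whose constant
  coefficient it divides already has large enough Mahler measure.\<close>

lemma ln_prime_le_Max_log_mahler:
  assumes bs: "bs \<in> alg_factorizations \<alpha>" and pow: "\<alpha> ^ k = of_nat D" and D: "D > 0"
    and p: "prime p" "p dvd D"
  shows "ln (real p) \<le> Max (log_mahler ` set bs)"
proof -
  obtain b where b: "b \<in> set bs" "int p dvd coeff (int_min_poly b) 0"
    using prime_dvd_const_coeff_of_factorization[OF bs pow p D] by blast
  have "algebraic b" "b \<noteq> 0" using b(1) bs by (auto simp: alg_factorizations_def)
  from sum_ln_prime_divisors_le_log_mahler[OF this, of "{p}"] p b
  have "ln (real p) \<le> log_mahler b" by simp
  also have "\<dots> \<le> Max (log_mahler ` set bs)" using b(1) by simp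
  finally show ?thesis .
qed

section \<open>Attainment of the infimum by the roots of the primes\<close>

theorem theorem1p4:
  fixes ps :: "nat list" and D k :: nat and t :: ereal
  assumes "ps \<noteq> []" and "distinct ps" and "\<forall>p\<in>set ps. prime p"
    and "D = prod_list ps"
    and "k \<ge> 1"
    and "t \<ge> 1"
  shows "t_metric_mahler_attained_by t (complex_of_real (root k (real D)))
           (map (\<lambda>p. complex_of_real (root k (real p))) ps) \<and>
         (t < \<infinity> \<longrightarrow>
           t_metric_mahler t (complex_of_real (root k (real D))) =
             (\<Sum>p\<leftarrow>ps. ln (real p) powr real_of_ereal t) powr (1 / real_of_ereal t)) \<and>
         (t = \<infinity> \<longrightarrow>
           t_metric_mahler t (complex_of_real (root k (real D))) =
             Max ((\<lambda>p. ln (real p)) ` set ps))"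
proof -
  define \<alpha> where "\<alpha> = complex_of_real (root k (real D))"
  define rs where "rs = map (\<lambda>p. complex_of_real (root k (real p))) ps"
  define \<tau> where "\<tau> = real_of_ereal t"
  have prime: "prime p" "p > 0" "p dvd D" if "p \<in> set ps" for p
    using that assms(3) by (auto simp: prime_gt_0_nat assms(4) intro: prod_list_dvd)
  have D: "D > 0" unfolding assms(4) using prime(2) by (metis gr0I less_irrefl prod_list_zero_iff)
  have pow: "\<alpha> ^ k = of_nat D"
    using assms(5) by (simp add: \<alpha>_def of_real_power[symmetric])
  have "prod_list rs = \<alpha>"
    unfolding rs_def \<alpha>_def assms(4) using assms(5)
    by (induction ps) (simp_all add: real_root_mult)
  moreover have "algebraic b \<and> b \<noteq> 0" if "b \<in> set rs" for b
    using that assms(5) by (auto simp: rs_def dest: prime(2))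
  ultimately have rs: "rs \<in> alg_factorizations \<alpha>"
    using assms(1) by (auto simp: alg_factorizations_def rs_def)
  \<comment> \<open>An equality of lists, so that both the power sum and the maximum can be read off
    from it.\<close>
  have log_rs: "map log_mahler rs = map (\<lambda>p. ln (real p)) ps"
    using log_mahler_root_prime[OF prime(1) assms(5)] by (simp add: rs_def)
  have fin: "t_mahler_of t bs = (\<Sum>b\<leftarrow>bs. log_mahler b powr \<tau>) powr (1 / \<tau>)"
    if "t \<noteq> \<infinity>" for bs using that by (simp add: t_mahler_of_def \<tau>_def)
  have rs_fin: "t_mahler_of t rs = (\<Sum>p\<leftarrow>ps. ln (real p) powr \<tau>) powr (1 / \<tau>)" if "t \<noteq> \<infinity>"
    using arg_cong[OF log_rs, of "map (\<lambda>x. x powr \<tau>)"] by (simp add: fin[OF that] comp_def)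
  have rs_inf: "t_mahler_of t rs = Max ((\<lambda>p. ln (real p)) ` set ps)" if "t = \<infinity>"
    using that arg_cong[OF log_rs, of set] by (simp add: t_mahler_of_def)
  have "t_mahler_of t rs \<le> t_mahler_of t bs" if bs: "bs \<in> alg_factorizations \<alpha>" for bs
  proof (cases "t = \<infinity>")
    case True
    have "Max ((\<lambda>p. ln (real p)) ` set ps) \<le> Max (log_mahler ` set bs)"
      using assms(1) ln_prime_le_Max_log_mahler[OF bs pow D prime(1,3)] by simp
    thus ?thesis unfolding rs_inf[OF True] by (simp add: t_mahler_of_def True)
  next
    case False
    hence \<tau>: "\<tau> \<ge> 1" using assms(6) by (cases t) (auto simp: \<tau>_def)
    \<comment> \<open>Distinctness of the primes enters here: the lower bound is for a sum over a
      set.\<close>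
    have "(\<Sum>p\<leftarrow>ps. ln (real p) powr \<tau>) = (\<Sum>p\<in>set ps. ln (real p) powr \<tau>)"
      using assms(2) by (rule sum_list_distinct_conv_sum_set)
    also have "\<dots> \<le> (\<Sum>b\<leftarrow>bs. log_mahler b powr \<tau>)"
      by (rule sum_ln_powr_le_sum_log_mahler_powr[OF bs pow D _ prime(1,3) \<tau>]) simp
    finally show ?thesis
      unfolding rs_fin[OF False] fin[OF False, of bs] using \<tau>
      by (intro powr_mono2 sum_list_nonneg) auto
  qed
  \<comment> \<open>\<open>rs\<close> is itself a factorization and has the least value, so the
    infimum is that value.\<close>
  hence "t_metric_mahler t \<alpha> = t_mahler_of t rs"
    unfolding t_metric_mahler_def using rs by (intro cInf_eq_minimum) auto
  with rs rs_fin rs_inf show ?thesis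
    by (auto simp: t_metric_mahler_attained_by_def \<alpha>_def rs_def \<tau>_def)
qed

end
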